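(* Let $F \colon \mathbb{R}^n \times \mathbb{R}^m \to \mathbb{R}^n$ be $C^1$. Assume that the recursion $x_{k+1} = F_\theta(x_k)$ converges globally (i.e. from every starting point $x_0 \in \mathbb{R}^n$), locally uniformly in $\theta$, to the unique fixed point $\bar{x}(\theta)$ of $F_\theta$, and that $J_x F(\bar{x}(\theta),\theta) = 0$ for every $\theta \in \mathbb{R}^m$. Assume moreover that, for every $\theta \in \mathbb{R}^m$, the map $x \mapsto J_{(x,\theta)} F(x,\theta)$ (joint Jacobian in $(x,\theta)$) is $L_J$-Lipschitz in operator norm. Then, for every $\theta \in \mathbb{R}^m$, the recursion is asymptotically quadratically convergent, and for each $k \geq 1$, $$\|J^{\mathrm{OS}} x_k(\theta) - J_\theta \bar{x}(\theta)\|_{\mathrm{op}} \leq L_J \|x_{k-1}(\theta) - \bar{x}(\theta)\|.$$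
   Context: Write $F_\theta \colon x \mapsto F(x,\theta)$. $J_x F(x,\theta) \in \mathbb{R}^{n\times n}$ and $J_\theta F(x,\theta) \in \mathbb{R}^{n \times m}$ denote the partial Jacobian matrices of $F$ with respect to its first and second variable, and $J_{(x,\theta)}F(x,\theta) \in \mathbb{R}^{n \times (n+m)}$ the full Jacobian. $\|\cdot\|$ is the Euclidean norm and $\|\cdot\|_{\mathrm{op}}$ the induced operator norm. The iterates are defined by $x_0(\theta) \in \mathbb{R}^n$ and $x_{k+1}(\theta) = F(x_k(\theta),\theta)$ for $k \geq 0$. Under the stated hypotheses, $\theta \mapsto \bar{x}(\theta)$ is $C^1$, with Jacobian denoted $J_\theta \bar{x}(\theta)$. The one-step estimator is defined, for $k \geq 1$, as $J^{\mathrm{OS}} x_k(\theta) := J_\theta F(x_{k-1}(\theta), \theta)$, i.e. the partial Jacobian of $F$ in its second variable evaluated at the point $(x_{k-1}(\theta),\theta)$ (the dependence of $x_{k-1}$ on $\theta$ is not differentiated). "Asymptotically quadratically convergent" means that $x_k(\theta) \to \bar{x}(\theta)$ and there is a constant $C \geq 0$ such that $\|x_{k+1}(\theta) - \bar{x}(\theta)\| \leq C \|x_k(\theta) - \bar{x}(\theta)\|^2$ for all sufficiently large $k$. *)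

theory Defs
  imports "HOL-Analysis.Analysis"
begin

definition C1_map :: "('a::real_normed_vector \<Rightarrow> 'b::real_normed_vector) \<Rightarrow> bool" where
  "C1_map f \<longleftrightarrow>
     (\<exists>f' :: 'a \<Rightarrow> 'a \<Rightarrow>\<^sub>L 'b.
        (\<forall>z. (f has_derivative blinfun_apply (f' z)) (at z)) \<and> continuous_on UNIV f')"

(* The norm of the type real^'n^'m is the Frobenius norm, so the operator norm needs its own name. *)
definition op_norm :: "real^'n^'m \<Rightarrow> real" where
  "op_norm A = onorm (\<lambda>v. A *v v)"

definition jacobian_x :: "((real^'n) \<times> (real^'m) \<Rightarrow> real^'n) \<Rightarrow> real^'n \<Rightarrow> real^'m \<Rightarrow> real^'n^'n" where
  "jacobian_x F x \<theta> = jacobian (\<lambda>y. F (y, \<theta>)) (at x)"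

definition jacobian_theta :: "((real^'n) \<times> (real^'m) \<Rightarrow> real^'n) \<Rightarrow> real^'n \<Rightarrow> real^'m \<Rightarrow> real^'m^'n" where
  "jacobian_theta F x \<theta> = jacobian (\<lambda>\<eta>. F (x, \<eta>)) (at \<theta>)"

(* The n x (n+m) matrix of the total derivative of F at (x, theta). Its columns are indexed by
   the sum type 'n + 'm: Inl p is the p-th coordinate of x, Inr q the q-th coordinate of theta. *)
definition jacobian_joint ::
  "((real^'n) \<times> (real^'m) \<Rightarrow> real^'n) \<Rightarrow> real^'n \<Rightarrow> real^'m \<Rightarrow> real^('n + 'm)^'n" where
  "jacobian_joint F x \<theta> =
     (\<chi> i j. frechet_derivative F (at (x, \<theta>))
        (case j of Inl p \<Rightarrow> (axis p 1, 0) | Inr q \<Rightarrow> (0, axis q 1)) $ i)"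

primrec iterate :: "('a \<times> 'b \<Rightarrow> 'a) \<Rightarrow> ('b \<Rightarrow> 'a) \<Rightarrow> nat \<Rightarrow> 'b \<Rightarrow> 'a" where
  "iterate F x0 0 \<theta> = x0 \<theta>"
| "iterate F x0 (Suc k) \<theta> = F (iterate F x0 k \<theta>, \<theta>)"

(* Meant for k \<ge> 1; the iterate is a fixed base point and is not differentiated in theta. *)
definition one_step ::
  "((real^'n) \<times> (real^'m) \<Rightarrow> real^'n) \<Rightarrow> (real^'m \<Rightarrow> real^'n) \<Rightarrow> nat \<Rightarrow> real^'m \<Rightarrow> real^'m^'n" where
  "one_step F x0 k \<theta> = jacobian_theta F (iterate F x0 (k - 1) \<theta>) \<theta>"

definition locally_uniform_limit ::
  "(nat \<Rightarrow> 'a::topological_space \<Rightarrow> 'b::metric_space) \<Rightarrow> ('a \<Rightarrow> 'b) \<Rightarrow> bool" where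
  "locally_uniform_limit f l \<longleftrightarrow>
     (\<forall>t. \<exists>U. open U \<and> t \<in> U \<and> uniform_limit U f l sequentially)"

definition asymp_quadratically_convergent ::
  "(nat \<Rightarrow> 'a::real_normed_vector) \<Rightarrow> 'a \<Rightarrow> bool" where
  "asymp_quadratically_convergent x l \<longleftrightarrow>
     x \<longlonglongrightarrow> l \<and>
     (\<exists>C\<ge>0. \<forall>\<^sub>F k in sequentially. norm (x (Suc k) - l) \<le> C * (norm (x k - l))\<^sup>2)"

end

theory Submission
  imports Defs
begin

text \<open>
  The limit \<open>xbar\<close> is continuous as a locally uniform limit of continuous iterates. Since
  \<open>J\<^sub>x F\<close> vanishes on its graph, the linearization of \<open>xbar \<theta> = F (xbar \<theta>, \<theta>)\<close> involves only the
  increment of \<open>\<theta>\<close>, so \<open>J\<^sub>\<theta> xbar(\<theta>) = J\<^sub>\<theta> F(xbar(\<theta>), \<theta>)\<close> without any inversion. Both estimates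
  then follow by restricting the Lipschitz joint Jacobian to the \<open>\<theta>\<close>-block, respectively to the
  \<open>x\<close>-block, where the mean value inequality on the segment from \<open>xbar \<theta>\<close> to \<open>x\<close> yields
  \<open>norm (F (x, \<theta>) - xbar \<theta>) \<le> L\<^sub>J * (norm (x - xbar \<theta>))\<^sup>2\<close>.
\<close>

lemma locally_uniform_limit_continuous:
  fixes f :: "nat \<Rightarrow> 'a::t2_space \<Rightarrow> 'b::metric_space"
  assumes lim: "locally_uniform_limit f l" and cont: "\<And>k. continuous_on UNIV (f k)"
  shows "continuous_on UNIV l"
proof -
  have "isCont l t" for t
  proof -
    obtain U where U: "open U" "t \<in> U" "uniform_limit U f l sequentially"
      using lim unfolding locally_uniform_limit_def by blast
    have "continuous_on U l"
      using continuous_on_subset[OF cont subset_UNIV]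
      by (intro uniform_limit_theorem[OF _ U(3)] always_eventually) auto
    then show ?thesis using U continuous_on_eq_continuous_at by blast
  qed
  then show ?thesis by (simp add: continuous_on_eq_continuous_within)
qed

lemma locally_uniform_limit_pointwise:
  assumes "locally_uniform_limit f l"
  shows "(\<lambda>k. f k t) \<longlonglongrightarrow> l t"
proof -
  obtain U where "t \<in> U" "uniform_limit U f l sequentially"
    using assms unfolding locally_uniform_limit_def by blast
  then show ?thesis using tendsto_uniform_limitI by fast
qed

lemma continuous_iterate:
  assumes "continuous_on UNIV F" "continuous_on UNIV x0"
  shows "continuous_on UNIV (iterate F x0 k)"
proof (induction k)
  case 0
  then show ?case using assms(2) by (simp add: iterate.simps(1)[abs_def])
next
  case (Suc k)
  then show ?case
    by (auto intro!: continuous_intros continuous_on_compose2[OF assms(1)])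
qed

lemma iterate_const: "iterate F x0 k \<theta> = iterate F (\<lambda>_. x0 \<theta>) k \<theta>"
  by (induction k) auto

lemma linear_Pair_blocks:
  fixes f :: "(real^'n) \<times> (real^'m) \<Rightarrow> 'b::real_vector"
  assumes "linear f"
  shows "f (u, v) = (\<Sum>p\<in>UNIV. u $ p *\<^sub>R f (axis p 1, 0)) + (\<Sum>q\<in>UNIV. v $ q *\<^sub>R f (0, axis q 1))"
proof -
  interpret f: linear f by fact
  have eq: "(u, v) = (\<Sum>p\<in>UNIV. u $ p *\<^sub>R (axis p 1, 0)) + (\<Sum>q\<in>UNIV. v $ q *\<^sub>R (0, axis q 1))"
    by (auto simp: prod_eq_iff fst_sum snd_sum vec_eq_iff axis_def if_distrib sum.delta cong: if_cong)
  show ?thesis by (subst eq) (simp only: f.add f.sum f.scale)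
qed

definition join_vec :: "real^'n \<Rightarrow> real^'m \<Rightarrow> real^('n + 'm)" where
  "join_vec u v = (\<chi> j. case j of Inl p \<Rightarrow> u $ p | Inr q \<Rightarrow> v $ q)"

lemma sum_UNIV_Plus:
  fixes g :: "'n::finite + 'm::finite \<Rightarrow> 'b::comm_monoid_add"
  shows "sum g UNIV = (\<Sum>p\<in>UNIV. g (Inl p)) + (\<Sum>q\<in>UNIV. g (Inr q))"
  using sum.Plus[of "UNIV :: 'n set" "UNIV :: 'm set" g] by (simp add: UNIV_Plus_UNIV)

lemma norm_join_vec: "norm (join_vec u v) = norm (u, v)"
  by (simp add: norm_vec_def L2_set_def join_vec_def sum_UNIV_Plus norm_Pair sum_nonneg)

lemma jacobian_joint_mult_join_vec:
  assumes "(F has_derivative f) (at (x, \<theta>))"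
  shows "jacobian_joint F x \<theta> *v join_vec u v = f (u, v)"
proof -
  have lin: "linear f" using assms has_derivative_linear by blast
  have f: "frechet_derivative F (at (x, \<theta>)) = f"
    using frechet_derivative_at[OF assms] by simp
  show ?thesis
    by (subst linear_Pair_blocks[OF lin])
      (simp add: vec_eq_iff matrix_vector_mult_def jacobian_joint_def join_vec_def sum_UNIV_Plus f
        mult.commute)
qed

lemma norm_mult_le_op_norm: "norm (A *v v) \<le> op_norm A * norm v"
  unfolding op_norm_def by (rule onorm) simp

lemma jacobian_unique:
  fixes f :: "real^'n \<Rightarrow> real^'m"
  assumes "(f has_derivative f') (at x)"
  shows "jacobian f (at x) *v h = f' h"
proof -
  have "linear f'" using assms has_derivative_linear by blast
  then show ?thesis
    by (simp add: jacobian_def frechet_derivative_at[OF assms, symmetric]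
        matrix_works linear_matrix_vector_mul_eq)
qed

text \<open>The implicit function theorem in the case where the partial derivative in \<open>x\<close> vanishes.\<close>

lemma has_derivative_superattracting_fixpoint:
  fixes F :: "'a::real_normed_vector \<times> 'b::real_normed_vector \<Rightarrow> 'a"
  assumes der: "(F has_derivative f) (at (x \<theta>, \<theta>))"
    and fixpt: "\<And>\<eta>. F (x \<eta>, \<eta>) = x \<eta>"
    and zero: "\<And>h. f (h, 0) = 0"
    and cont: "isCont x \<theta>"
  shows "(x has_derivative (\<lambda>k. f (0, k))) (at \<theta>)"
proof -
  interpret f: bounded_linear f using der by (rule has_derivative_bounded_linear)
  define D where "D = (\<lambda>k. f (0, k))"
  have bl: "bounded_linear D"
    unfolding D_def
    by (rule bounded_linear_compose[OF f.bounded_linear_axioms])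
      (intro bounded_linear_Pair bounded_linear_zero bounded_linear_ident)
  then obtain K where K: "K > 0" "\<And>k. norm (D k) \<le> norm k * K"
    using bounded_linear.pos_bounded by blast
  have fD: "f (h, k) = D k" for h k
    using f.add[of "(h, 0)" "(0, k)"] zero by (simp add: D_def)
  have "\<exists>d>0. \<forall>\<eta>. norm (\<eta> - \<theta>) < d \<longrightarrow>
      norm (x \<eta> - x \<theta> - D (\<eta> - \<theta>)) \<le> e * norm (\<eta> - \<theta>)" if e: "e > 0" for e
  proof -
    define c where "c = min (1/2) (e / (2 * K + 2))"
    have c: "c > 0" "c \<le> 1/2" "c \<le> e / (2 * K + 2)"
      using e K(1) unfolding c_def by (simp_all only: min.cobounded1 min.cobounded2) simp
    then have cK: "c * (2 * K + 2) \<le> e"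
      using K(1) by (simp add: pos_le_divide_eq)
    obtain d where d: "d > 0"
      "\<And>z. norm (z - (x \<theta>, \<theta>)) < d \<Longrightarrow>
        norm (F z - F (x \<theta>, \<theta>) - f (z - (x \<theta>, \<theta>))) \<le> c * norm (z - (x \<theta>, \<theta>))"
      using der c(1) unfolding has_derivative_at_alt by blast
    obtain s where s: "s > 0" "\<And>\<eta>. norm (\<eta> - \<theta>) < s \<Longrightarrow> norm (x \<eta> - x \<theta>) < d / 2"
      using cont d(1) unfolding continuous_at_eps_delta dist_norm by (meson half_gt_zero)
    have "norm (x \<eta> - x \<theta> - D (\<eta> - \<theta>)) \<le> e * norm (\<eta> - \<theta>)"
      if \<eta>: "norm (\<eta> - \<theta>) < min s (d / 2)" for \<eta>
    proof -
      let ?X = "norm (x \<eta> - x \<theta>)" and ?T = "norm (\<eta> - \<theta>)"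
      have le: "norm ((x \<eta>, \<eta>) - (x \<theta>, \<theta>)) \<le> ?X + ?T"
        using norm_Pair_le[of "x \<eta> - x \<theta>" "\<eta> - \<theta>"] by simp
      also have "\<dots> < d" using s(2)[of \<eta>] \<eta> by simp
      finally have "norm (x \<eta> - x \<theta> - D (\<eta> - \<theta>)) \<le> c * norm ((x \<eta>, \<eta>) - (x \<theta>, \<theta>))"
        using d(2)[of "(x \<eta>, \<eta>)"] by (simp add: fixpt fD)
      also have "\<dots> \<le> c * (?X + ?T)" using le c(1) by simp
      finally have 1: "norm (x \<eta> - x \<theta> - D (\<eta> - \<theta>)) \<le> c * (?X + ?T)" .
      have "?X \<le> norm (x \<eta> - x \<theta> - D (\<eta> - \<theta>)) + norm (D (\<eta> - \<theta>))"
        using norm_triangle_sub[of "x \<eta> - x \<theta>" "D (\<eta> - \<theta>)"] by simp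
      also have "\<dots> \<le> c * (?X + ?T) + ?T * K" using 1 K(2) by (intro add_mono)
      also have "\<dots> \<le> 1/2 * (?X + ?T) + ?T * K"
        using c(2) by (intro add_right_mono mult_right_mono) auto
      finally have "?X + ?T \<le> (2 * K + 2) * ?T" by (simp add: algebra_simps)
      then have "c * (?X + ?T) \<le> c * (2 * K + 2) * ?T" using c(1) by simp
      also have "\<dots> \<le> e * ?T" using cK by (rule mult_right_mono) simp
      finally show ?thesis using 1 by linarith
    qed
    moreover have "min s (d / 2) > 0" using s(1) d(1) by simp
    ultimately show ?thesis by blast
  qed
  then show ?thesis using bl unfolding has_derivative_at_alt D_def[symmetric] by blast
qed

theorem corollary3:
  fixes F :: "(real^'n) \<times> (real^'m) \<Rightarrow> real^'n"
    and xbar :: "real^'m \<Rightarrow> real^'n"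
    and L\<^sub>J :: real
  assumes C1: "C1_map F"
    and fixpoint: "\<And>\<theta> x. F (x, \<theta>) = x \<longleftrightarrow> x = xbar \<theta>"
    and convergence: "\<And>c :: real^'n. locally_uniform_limit (iterate F (\<lambda>_. c)) xbar"
    and superattracting: "\<And>\<theta>. jacobian_x F (xbar \<theta>) \<theta> = 0"
    and Lipschitz: "\<And>\<theta> x y.
      op_norm (jacobian_joint F x \<theta> - jacobian_joint F y \<theta>) \<le> L\<^sub>J * norm (x - y)"
  shows "C1_map xbar \<and>
    (\<forall>(x0 :: real^'m \<Rightarrow> real^'n) \<theta>.
      asymp_quadratically_convergent (\<lambda>k. iterate F x0 k \<theta>) (xbar \<theta>) \<and>
      (\<forall>k\<ge>1. op_norm (one_step F x0 k \<theta> - jacobian xbar (at \<theta>))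
               \<le> L\<^sub>J * norm (iterate F x0 (k - 1) \<theta> - xbar \<theta>)))"
proof -
  obtain F' where F': "\<And>z. (F has_derivative blinfun_apply (F' z)) (at z)"
    and contF': "continuous_on UNIV F'"
    using C1 unfolding C1_map_def by blast
  have contF: "continuous_on UNIV F"
    using F' has_derivative_continuous continuous_at_imp_continuous_on by blast
  have contx: "continuous_on UNIV xbar"
    using locally_uniform_limit_continuous[OF convergence[of 0]] continuous_iterate[OF contF]
    by simp
  have derx: "((\<lambda>y. F (y, \<theta>)) has_derivative (\<lambda>h. F' (x, \<theta>) (h, 0))) (at x)" for x \<theta>
    by (rule has_derivative_compose[OF _ F', where f = "\<lambda>y. (y, \<theta>)"])
      (auto intro!: derivative_eq_intros)
  have der\<theta>: "((\<lambda>\<eta>. F (x, \<eta>)) has_derivative (\<lambda>k. F' (x, \<theta>) (0, k))) (at \<theta>)" for x \<theta>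
    by (rule has_derivative_compose[OF _ F', where f = "\<lambda>\<eta>. (x, \<eta>)"])
      (auto intro!: derivative_eq_intros)
  have zero: "F' (xbar \<theta>, \<theta>) (h, 0) = 0" for h \<theta>
    using jacobian_unique[OF derx[of \<theta> "xbar \<theta>"], of h] superattracting[of \<theta>]
    by (simp add: jacobian_x_def)
  have fixpt: "F (xbar \<theta>, \<theta>) = xbar \<theta>" for \<theta>
    using fixpoint by simp
  have derxbar: "(xbar has_derivative (\<lambda>k. F' (xbar \<theta>, \<theta>) (0, k))) (at \<theta>)" for \<theta>
    using F' fixpt zero contx
    by (intro has_derivative_superattracting_fixpoint) (auto simp: continuous_on_eq_continuous_at)
  have "C1_map xbar"
  proof -
    have bl: "bounded_linear (\<lambda>k::real^'m. (0::real^'n, k))"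
      by (intro bounded_linear_Pair bounded_linear_zero bounded_linear_ident)
    define G where "G \<theta> = F' (xbar \<theta>, \<theta>) o\<^sub>L Blinfun (\<lambda>k. (0, k))" for \<theta>
    have "(xbar has_derivative blinfun_apply (G \<theta>)) (at \<theta>)" for \<theta>
      using derxbar[of \<theta>] by (simp add: G_def bounded_linear_Blinfun_apply[OF bl] blinfun_compose.rep_eq o_def)
    moreover have "continuous_on UNIV G"
      unfolding G_def
      by (intro continuous_intros continuous_on_compose2[OF contF'] contx) auto
    ultimately show ?thesis unfolding C1_map_def by blast
  qed
  have Lip: "norm (F' (x, \<theta>) w - F' (y, \<theta>) w) \<le> L\<^sub>J * norm (x - y) * norm w" for x y \<theta> w
  proof -
    obtain u v where w: "w = (u, v)" by fastforce
    let ?A = "jacobian_joint F x \<theta> - jacobian_joint F y \<theta>"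
    have "norm (F' (x, \<theta>) w - F' (y, \<theta>) w) = norm (?A *v join_vec u v)"
      by (simp add: w matrix_vector_mult_diff_rdistrib jacobian_joint_mult_join_vec[OF F'])
    also have "\<dots> \<le> op_norm ?A * norm w"
      using norm_mult_le_op_norm[of ?A "join_vec u v"] by (simp add: w norm_join_vec)
    also have "\<dots> \<le> L\<^sub>J * norm (x - y) * norm w"
      using Lipschitz by (rule mult_right_mono) simp
    finally show ?thesis .
  qed
  have quadratic: "norm (F (x, \<theta>) - xbar \<theta>) \<le> \<bar>L\<^sub>J\<bar> * (norm (x - xbar \<theta>))\<^sup>2" for x \<theta>
  proof -
    have "norm (F (x, \<theta>) - F (xbar \<theta>, \<theta>)) \<le> (\<bar>L\<^sub>J\<bar> * norm (x - xbar \<theta>)) * norm (x - xbar \<theta>)"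
    proof (rule differentiable_bound[where S = "closed_segment (xbar \<theta>) x"
            and f = "\<lambda>y. F (y, \<theta>)" and f' = "\<lambda>y h. F' (y, \<theta>) (h, 0)"])
      fix y assume y: "y \<in> closed_segment (xbar \<theta>) x"
      show "((\<lambda>y. F (y, \<theta>)) has_derivative (\<lambda>h. F' (y, \<theta>) (h, 0)))
              (at y within closed_segment (xbar \<theta>) x)"
        using derx has_derivative_at_withinI by blast
      show "onorm (\<lambda>h. F' (y, \<theta>) (h, 0)) \<le> \<bar>L\<^sub>J\<bar> * norm (x - xbar \<theta>)"
      proof (rule onorm_bound)
        fix h :: "real^'n"
        have "norm (F' (y, \<theta>) (h, 0)) \<le> L\<^sub>J * norm (y - xbar \<theta>) * norm h"
          using Lip[of y \<theta> "(h, 0)" "xbar \<theta>"] by (simp add: zero norm_Pair)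
        also have "\<dots> \<le> \<bar>L\<^sub>J\<bar> * norm (x - xbar \<theta>) * norm h"
          using segment_bound(1)[OF y] by (intro mult_right_mono mult_mono) auto
        finally show "norm (F' (y, \<theta>) (h, 0)) \<le> \<bar>L\<^sub>J\<bar> * norm (x - xbar \<theta>) * norm h" .
      qed simp
    qed auto
    then show ?thesis by (simp add: fixpt power2_eq_square mult.assoc)
  qed
  have "asymp_quadratically_convergent (\<lambda>k. iterate F x0 k \<theta>) (xbar \<theta>)" for x0 \<theta>
  proof -
    have "(\<lambda>k. iterate F x0 k \<theta>) \<longlonglongrightarrow> xbar \<theta>"
      using locally_uniform_limit_pointwise[OF convergence] by (subst iterate_const)
    moreover have "\<forall>\<^sub>F k in sequentially.
        norm (iterate F x0 (Suc k) \<theta> - xbar \<theta>) \<le> \<bar>L\<^sub>J\<bar> * (norm (iterate F x0 k \<theta> - xbar \<theta>))\<^sup>2"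
      by (simp add: quadratic)
    ultimately show ?thesis
      unfolding asymp_quadratically_convergent_def using abs_ge_zero by blast
  qed
  moreover have "op_norm (one_step F x0 k \<theta> - jacobian xbar (at \<theta>))
      \<le> L\<^sub>J * norm (iterate F x0 (k - 1) \<theta> - xbar \<theta>)" for x0 k \<theta>
    unfolding op_norm_def
  proof (rule onorm_le)
    fix v :: "real^'m"
    show "norm ((one_step F x0 k \<theta> - jacobian xbar (at \<theta>)) *v v)
        \<le> L\<^sub>J * norm (iterate F x0 (k - 1) \<theta> - xbar \<theta>) * norm v"
      using Lip[of "iterate F x0 (k - 1) \<theta>" \<theta> "(0, v)" "xbar \<theta>"]
      by (simp add: one_step_def jacobian_theta_def matrix_vector_mult_diff_rdistrib
          jacobian_unique[OF der\<theta>] jacobian_unique[OF derxbar] norm_Pair)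
  qed
  ultimately show ?thesis using \<open>C1_map xbar\<close> by blast
qed

end
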